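(* Let $k \ge 3$, let $r_1 \geq r_2 \geq \cdots \geq r_k\ge 1$ be integers, and let $n = \sum_{i=1}^{k} r_i$. Then $A(r_1, r_2, \ldots, r_k) \leq 2(n - r_1 - 1)$.
   Context: $A(r_1,r_2,\dots,r_k)$ denotes the minimum, over all choices of pairwise disjoint sets $\mathcal P_1,\dots,\mathcal P_k\subset\mathbb{R}^2$ with $|\mathcal P_i| = r_i$ and whose union is not all collinear, of the number of distinct values in $(0,\pi)$ of angles $\angle xyz$ whose three points $x,y,z$ lie in three distinct sets among $\mathcal P_1,\dots,\mathcal P_k$. *)

theory Defs
  imports "HOL-Analysis.Analysis" "HOL-Library.Disjoint_Sets"
begin

text \<open>The unoriented angle \<open>\<angle>xyz\<close> with vertex \<open>y\<close>, in \<open>[0, \<pi>]\<close>; it is only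
  meaningful for \<open>x \<noteq> y\<close> and \<open>z \<noteq> y\<close>.\<close>

definition angle :: "real^2 \<Rightarrow> real^2 \<Rightarrow> real^2 \<Rightarrow> real" where
  "angle x y z = arccos (((x - y) \<bullet> (z - y)) / (norm (x - y) * norm (z - y)))"

definition admissible :: "nat \<Rightarrow> (nat \<Rightarrow> nat) \<Rightarrow> (nat \<Rightarrow> (real^2) set) \<Rightarrow> bool" where
  "admissible k r P \<longleftrightarrow>
     (\<forall>i\<in>{1..k}. finite (P i) \<and> card (P i) = r i) \<and>
     disjoint_family_on P {1..k} \<and>
     \<not> collinear (\<Union>i\<in>{1..k}. P i)"

definition multipartite_angles :: "nat \<Rightarrow> (nat \<Rightarrow> (real^2) set) \<Rightarrow> real set" where
  "multipartite_angles k P =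
     {angle x y z | x y z a b c.
        a \<in> {1..k} \<and> b \<in> {1..k} \<and> c \<in> {1..k} \<and> a \<noteq> b \<and> b \<noteq> c \<and> a \<noteq> c \<and>
        x \<in> P a \<and> y \<in> P b \<and> z \<in> P c} \<inter> {0<..<pi}"

text \<open>The quantity \<open>A(r\<^sub>1, \<dots>, r\<^sub>k)\<close>; only the values \<open>r 1, \<dots>, r k\<close> matter. For a nonempty
  set of naturals \<open>Inf\<close> is its least element. Whenever some admissible configuration exists
  (e.g. if \<open>k \<ge> 3\<close> and all \<open>r i \<ge> 1\<close>), this is therefore an attained minimum.\<close>

definition A :: "nat \<Rightarrow> (nat \<Rightarrow> nat) \<Rightarrow> nat" where
  "A k r = Inf {card (multipartite_angles k P) | P. admissible k r P}"

end

theory Submission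
  imports Defs
begin

text \<open>Let \<open>m = n - r\<^sub>1 \<ge> 2\<close>. Put all points on a line except for a single point \<open>q\<close> of the
  largest class. A triple of collinear points contributes only the angles \<open>0\<close> and \<open>\<pi>\<close>, and a triple
  containing \<open>q\<close> contains no other point of the first class. So only \<open>q\<close> and the \<open>m\<close> points of the
  remaining classes matter; place these such that they are seen from \<open>q\<close> in the directions \<open>j\<pi> / (m + 1)\<close>,
  measured from the line, for \<open>1 \<le> j \<le> m\<close>. Then every angle is again of the form \<open>j\<pi> / (m + 1)\<close>, so
  there are at most \<open>m \<le> 2 (m - 1)\<close> of them.\<close>

section \<open>Angles as differences of polar angles\<close>

definition dir :: "real \<Rightarrow> real^2" where
  "dir t = vector [cos t, sin t]"

lemma dir_nth [simp]: "dir t $ 1 = cos t" "dir t $ 2 = sin t"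
  by (simp_all add: dir_def)

lemma inner_dir: "dir a \<bullet> dir b = cos (a - b)"
  by (simp add: inner_vec_def sum_2 cos_diff)

lemma norm_dir [simp]: "norm (dir a) = 1"
  by (simp add: norm_eq_sqrt_inner inner_dir)

lemma angle_commute: "angle x y z = angle z y x"
  by (simp add: angle_def inner_commute mult.commute)

text \<open>The positive lengths cancel in the quotient, which leaves \<open>cos (a - b)\<close>.
  The bound by \<open>pi\<close> makes \<open>arccos\<close> return \<open>\<bar>a - b\<bar>\<close>
  itself, so polar angles are chosen below to lie within \<open>pi\<close> of each other.\<close>

lemma angle_polar:
  assumes "x - y = s *\<^sub>R dir a" "z - y = t *\<^sub>R dir b" "s > 0" "t > 0" "\<bar>a - b\<bar> \<le> pi"
  shows "angle x y z = \<bar>a - b\<bar>"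
  using assms by (simp add: angle_def inner_dir arccos_cos_eq_abs)

section \<open>The horizontal axis and a point above it\<close>

definition line_point :: "real \<Rightarrow> real^2" where
  "line_point t = vector [t, 0]"

text \<open>The point q of the overview. Height 1 gives the axis point seen at depression
  \<open>a\<close> the abscissa \<open>cot a\<close>.\<close>

definition apex :: "real^2" where
  "apex = vector [0, 1]"

lemma line_point_nth [simp]: "line_point t $ 1 = t" "line_point t $ 2 = 0"
  by (simp_all add: line_point_def)

lemma apex_nth [simp]: "apex $ 1 = 0" "apex $ 2 = 1"
  by (simp_all add: apex_def)

lemma line_point_eq_iff [simp]: "line_point s = line_point t \<longleftrightarrow> s = t"
  by (metis line_point_nth(1))

lemma apex_neq_line_point [simp]: "apex \<noteq> line_point t" "line_point t \<noteq> apex"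
  by (auto simp: vec_eq_iff forall_2)

lemma line_point_diff:
  assumes "s \<noteq> t"
  obtains d b where "line_point s - line_point t = d *\<^sub>R dir b" "d > 0" "b = 0 \<or> b = pi"
proof (cases "s > t")
  case True
  then show ?thesis
    using that[of "s - t" 0] by (simp add: vec_eq_iff forall_2)
next
  case False
  then show ?thesis
    using that[of "t - s" pi] assms by (simp add: vec_eq_iff forall_2)
qed

text \<open>Both arms have polar angle 0 or \<open>pi\<close>. These values lie outside the open
  interval in which angles are counted.\<close>

lemma angle_line_points:
  assumes "s \<noteq> u" "t \<noteq> u"
  shows "angle (line_point s) (line_point u) (line_point t) \<in> {0, pi}"
proof -
  obtain d a where d: "line_point s - line_point u = d *\<^sub>R dir a" "d > 0" "a = 0 \<or> a = pi"
    using line_point_diff assms(1) .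
  obtain e b where e: "line_point t - line_point u = e *\<^sub>R dir b" "e > 0" "b = 0 \<or> b = pi"
    using line_point_diff assms(2) .
  show ?thesis
    using angle_polar[OF d(1) e(1)] d e by auto
qed

text \<open>The vector is \<open>(cot a, -1)\<close>, which is \<open>(cos a, - sin a)\<close>
  divided by \<open>sin a > 0\<close>.\<close>

lemma cot_point_diff_apex:
  assumes "0 < a" "a < pi"
  shows "line_point (cot a) - apex = (1 / sin a) *\<^sub>R dir (- a)"
  using sin_gt_zero[OF assms] by (simp add: vec_eq_iff forall_2 cot_def)

lemma apex_diff_cot_point:
  assumes "0 < a" "a < pi"
  shows "apex - line_point (cot a) = (1 / sin a) *\<^sub>R dir (pi - a)"
  using sin_gt_zero[OF assms] by (simp add: vec_eq_iff forall_2 cot_def)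

lemma angle_at_apex:
  assumes "0 < a" "a < pi" "0 < b" "b < pi"
  shows "angle (line_point (cot a)) apex (line_point (cot b)) = \<bar>a - b\<bar>"
  using angle_polar[OF cot_point_diff_apex[OF assms(1,2)] cot_point_diff_apex[OF assms(3,4)]]
    sin_gt_zero assms by auto

text \<open>The arm to \<open>apex\<close> has polar angle \<open>pi - a\<close>, the arm along the
  axis \<open>0\<close> or \<open>pi\<close>; the side on which \<open>t\<close> lies decides
  between the two values.\<close>

lemma angle_at_cot_point:
  assumes "0 < a" "a < pi" "t \<noteq> cot a"
  shows "angle apex (line_point (cot a)) (line_point t) \<in> {a, pi - a}"
proof -
  obtain d b where d: "line_point t - line_point (cot a) = d *\<^sub>R dir b" "d > 0" "b = 0 \<or> b = pi"
    using line_point_diff assms(3) .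
  show ?thesis
    using angle_polar[OF apex_diff_cot_point[OF assms(1,2)] d(1)] d sin_gt_zero assms by auto
qed

text \<open>Equal cotangents force \<open>sin (a - b) = 0\<close>, and \<open>a - b\<close> lies
  strictly between \<open>- pi\<close> and \<open>pi\<close>.\<close>

lemma inj_on_cot: "inj_on cot {0<..<pi}"
proof (rule inj_onI)
  fix a b :: real
  assume *: "a \<in> {0<..<pi}" "b \<in> {0<..<pi}" "cot a = cot b"
  then have "sin a > 0" "sin b > 0"
    by (auto intro: sin_gt_zero)
  with * have "sin (a - b) = 0"
    by (simp add: cot_def sin_diff field_simps)
  then show "a = b"
    using * sin_eq_0_pi[of "a - b"] by auto
qed

text \<open>Two distinct axis points make a common direction \<open>u\<close> horizontal, but
  reaching \<open>apex\<close> needs a nonzero second coordinate.\<close>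

lemma not_collinear_apex:
  assumes "s \<noteq> t" "apex \<in> S" "line_point s \<in> S" "line_point t \<in> S"
  shows "\<not> collinear S"
proof
  assume "collinear S"
  then obtain u where u: "\<And>x y. x \<in> S \<Longrightarrow> y \<in> S \<Longrightarrow> \<exists>c. x - y = c *\<^sub>R u"
    by (auto simp: collinear_def)
  obtain c where c: "line_point s - line_point t = c *\<^sub>R u"
    using u assms by blast
  obtain d where d: "apex - line_point t = d *\<^sub>R u"
    using u assms by blast
  have "s - t = c * u $ 1" "0 = c * u $ 2" "1 = d * u $ 2"
    using arg_cong[OF c, of "\<lambda>v. v $ 1"] arg_cong[OF c, of "\<lambda>v. v $ 2"]
      arg_cong[OF d, of "\<lambda>v. v $ 2"] by simp_all
  with assms(1) show False
    by auto
qed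

text \<open>The disjoint union of blocks of sizes \<open>r i\<close> has as many elements as
  \<open>X\<close>; a bijection carries the blocks over to \<open>X\<close>. This distributes the
  points seen from \<open>apex\<close> among the classes \<open>2..k\<close>.\<close>

lemma ex_disjoint_family_cards:
  fixes r :: "'i \<Rightarrow> nat"
  assumes "finite I" "finite X" "card X = (\<Sum>i\<in>I. r i)"
  shows "\<exists>Q. (\<forall>i\<in>I. card (Q i) = r i) \<and> disjoint_family_on Q I \<and> (\<Union>i\<in>I. Q i) = X"
proof -
  have "card (SIGMA i:I. {..<r i}) = card X"
    using assms by simp
  then obtain h where h: "bij_betw h (SIGMA i:I. {..<r i}) X"
    using assms by (metis finite_SigmaI finite_lessThan finite_same_card_bij)
  define Q where "Q i = h ` ({i} \<times> {..<r i})" for i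
  have inj: "inj_on h (SIGMA i:I. {..<r i})"
    using h by (simp add: bij_betw_def)
  have "card (Q i) = r i" if "i \<in> I" for i
  proof -
    have "inj_on h ({i} \<times> {..<r i})"
      using that by (intro inj_on_subset[OF inj]) auto
    then show ?thesis
      by (simp add: Q_def card_image card_cartesian_product)
  qed
  moreover have "disjoint_family_on Q I"
    using inj by (fastforce simp: disjoint_family_on_def Q_def inj_on_def)
  moreover have "(\<Union>i\<in>I. Q i) = h ` (SIGMA i:I. {..<r i})"
    by (auto simp: Q_def)
  ultimately show ?thesis
    using h by (metis bij_betw_def)
qed

section \<open>The configuration and its angles\<close>

lemma ex_admissible_few_angles:
  fixes k :: nat and r :: "nat \<Rightarrow> nat"
  defines "m \<equiv> (\<Sum>i=2..k. r i)"
  assumes "k \<ge> 1" "r 1 \<ge> 1" "m \<ge> 2"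
  shows "\<exists>P. admissible k r P \<and> card (multipartite_angles k P) \<le> m"
proof -
  \<comment> \<open>With denominator \<open>m + 1\<close>, the multiples strictly between 0 and
    \<open>pi\<close> are exactly those for \<open>1..m\<close>. This set is closed under distances
    of distinct members and under supplements, the only operations that the angles require.\<close>
  define \<theta> where "\<theta> j = real j * pi / real (m + 1)" for j
  have \<theta>_bounds: "0 < \<theta> j" "\<theta> j < pi" if "j \<in> {1..m}" for j
  proof -
    have "real j * pi < real (m + 1) * pi"
      using that by (intro mult_strict_right_mono) auto
    then show "0 < \<theta> j" "\<theta> j < pi"
      using that by (simp_all add: \<theta>_def pos_divide_less_eq mult.commute)
  qed
  have \<theta>_diff: "\<bar>\<theta> i - \<theta> j\<bar> \<in> \<theta> ` {1..m}" if "i \<in> {1..m}" "j \<in> {1..m}" "i \<noteq> j" for i j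
  proof -
    have *: "\<bar>\<theta> i - \<theta> j\<bar> \<in> \<theta> ` {1..m}" if "i \<in> {1..m}" "j \<in> {1..m}" "j < i" for i j
    proof -
      have "\<theta> i - \<theta> j = \<theta> (i - j)"
        using that by (simp add: \<theta>_def of_nat_diff left_diff_distrib diff_divide_distrib)
      moreover have "i - j \<in> {1..m}"
        using that by auto
      ultimately show ?thesis
        using \<theta>_bounds(1)[of "i - j"] by simp
    qed
    show ?thesis
      using *[of i j] *[of j i] that by (cases "j < i") (auto simp: abs_minus_commute)
  qed
  have \<theta>_compl: "pi - \<theta> j \<in> \<theta> ` {1..m}" if "j \<in> {1..m}" for j
  proof -
    have "pi - \<theta> j = \<theta> (m + 1 - j)"
      using that by (simp add: \<theta>_def of_nat_diff field_simps)
    moreover have "m + 1 - j \<in> {1..m}"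
      using that by auto
    ultimately show ?thesis
      by simp
  qed
  have "inj_on \<theta> {1..m}"
    by (rule inj_onI) (simp add: \<theta>_def)
  then have inj: "inj_on (cot \<circ> \<theta>) {1..m}"
    using \<theta>_bounds by (intro comp_inj_on inj_on_subset[OF inj_on_cot]) auto
  define X where "X = (cot \<circ> \<theta>) ` {1..m}"
  have "card X = (\<Sum>i\<in>{2..k}. r i)"
    using card_image[OF inj] by (simp add: X_def m_def)
  moreover have fin_X: "finite X"
    by (simp add: X_def)
  ultimately obtain Q where Q: "\<And>i. i \<in> {2..k} \<Longrightarrow> card (Q i) = r i"
      "disjoint_family_on Q {2..k}" "(\<Union>i\<in>{2..k}. Q i) = X"
    using ex_disjoint_family_cards[of "{2..k}" X r] by blast
  \<comment> \<open>The other \<open>r 1 - 1\<close> points of the first class may sit anywhere on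
    the axis off \<open>X\<close>: they share no counted triple with \<open>apex\<close>.\<close>
  have "infinite (UNIV - X)"
    by (simp add: X_def Diff_infinite_finite infinite_UNIV_char_0)
  then obtain E where E: "finite E" "card E = r 1 - 1" "E \<inter> X = {}"
    using infinite_arbitrarily_large[of "UNIV - X" "r 1 - 1"] by blast
  define P where "P i = (if i = 1 then insert apex (line_point ` E) else line_point ` Q i)" for i :: nat
  have inj_lp: "inj_on line_point S" for S
    by (simp add: inj_on_def)
  have Q_sub: "Q i \<subseteq> X" if "i \<in> {1..k}" "i \<noteq> 1" for i
    using Q(3) that by force
  have fin: "finite (P i)" if "i \<in> {1..k}" for i
    using that E(1) finite_subset[OF Q_sub[of i] fin_X] by (auto simp: P_def)
  have card: "card (P i) = r i" if "i \<in> {1..k}" for i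
  proof (cases "i = 1")
    case True
    have "apex \<notin> line_point ` E"
      by auto
    then show ?thesis
      using True E \<open>r 1 \<ge> 1\<close> by (simp add: P_def card_image[OF inj_lp])
  next
    case False
    then show ?thesis
      using that Q(1) by (simp add: P_def card_image[OF inj_lp])
  qed
  have disj: "disjoint_family_on P {1..k}"
  proof (unfold disjoint_family_on_def, intro ballI impI)
    have *: "P i \<inter> P j = {}" if "i \<in> {1..k}" "j \<in> {1..k}" "i < j" for i j
    proof (cases "i = 1")
      case True
      then show ?thesis
        using Q_sub[of j] E(3) that by (auto simp: P_def)
    next
      case False
      then have "Q i \<inter> Q j = {}"
        using Q(2) that by (auto simp: disjoint_family_on_def)
      then show ?thesis
        using False that by (auto simp: P_def)
    qed
    fix i j assume "i \<in> {1..k}" "j \<in> {1..k}" "i \<noteq> j"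
    then show "P i \<inter> P j = {}"
      using *[of i j] *[of j i] by (cases "i < j") auto
  qed
  have "\<not> collinear (\<Union>i\<in>{1..k}. P i)"
  proof (rule not_collinear_apex)
    \<comment> \<open>Both indices are in range because \<open>m \<ge> 2\<close>.\<close>
    show "cot (\<theta> 1) \<noteq> cot (\<theta> 2)"
      using inj_onD[OF inj, of 1 2] \<open>m \<ge> 2\<close> by auto
    show "apex \<in> (\<Union>i\<in>{1..k}. P i)"
      using \<open>k \<ge> 1\<close> by (auto simp: P_def)
    have "line_point ` X \<subseteq> (\<Union>i\<in>{1..k}. P i)"
    proof -
      have "line_point ` Q i \<subseteq> P i" if "i \<in> {2..k}" for i
        using that by (simp add: P_def)
      then show ?thesis
        unfolding Q(3)[symmetric] image_UN by (intro UN_mono) auto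
    qed
    moreover have "cot (\<theta> 1) \<in> X" "cot (\<theta> 2) \<in> X"
      using \<open>m \<ge> 2\<close> by (auto simp: X_def)
    ultimately show "line_point (cot (\<theta> 1)) \<in> (\<Union>i\<in>{1..k}. P i)"
        "line_point (cot (\<theta> 2)) \<in> (\<Union>i\<in>{1..k}. P i)"
      by auto
  qed
  with fin card disj have adm: "admissible k r P"
    by (simp add: admissible_def)
  have line: "\<exists>t. x = line_point t" if "x \<in> P i" "x \<noteq> apex" for x i
    using that by (auto simp: P_def split: if_splits)
  have apex_class: "i = 1" if "apex \<in> P i" for i
    using that by (auto simp: P_def split: if_splits)
  have other: "\<exists>j\<in>{1..m}. x = line_point (cot (\<theta> j))" if "x \<in> P i" "i \<in> {1..k}" "i \<noteq> 1" for x i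
    using that Q_sub[of i] by (auto simp: P_def X_def)
  \<comment> \<open>Classes other than the first contain only cotangent points, so the angle at
    \<open>y\<close> is some \<open>\<theta> i\<close> or its supplement.\<close>
  have end_apex: "angle apex y z \<in> \<theta> ` {1..m}"
    if yz: "y \<in> P b" "z \<in> P c" "b \<in> {1..k}" "c \<in> {1..k}" "b \<noteq> 1" "c \<noteq> 1" "y \<noteq> z" for y z b c
  proof -
    obtain i where i: "i \<in> {1..m}" "y = line_point (cot (\<theta> i))"
      using other[OF yz(1,3,5)] by blast
    obtain j where j: "j \<in> {1..m}" "z = line_point (cot (\<theta> j))"
      using other[OF yz(2,4,6)] by blast
    show ?thesis
      using angle_at_cot_point[OF \<theta>_bounds[OF i(1)], of "cot (\<theta> j)"] \<theta>_compl[OF i(1)] i j yz(7)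
      by auto
  qed
  have "multipartite_angles k P \<subseteq> \<theta> ` {1..m}"
  proof
    fix v assume "v \<in> multipartite_angles k P"
    then obtain x y z a b c where v: "v = angle x y z" "v \<in> {0<..<pi}"
      and idx: "a \<in> {1..k}" "b \<in> {1..k}" "c \<in> {1..k}" "a \<noteq> b" "b \<noteq> c" "a \<noteq> c"
      and pts: "x \<in> P a" "y \<in> P b" "z \<in> P c"
      by (auto simp: multipartite_angles_def)
    have dist: "x \<noteq> y" "y \<noteq> z" "x \<noteq> z"
      using disj idx pts unfolding disjoint_family_on_def by blast+
    consider "x = apex" | "y = apex" | "z = apex" | "x \<noteq> apex" "y \<noteq> apex" "z \<noteq> apex"
      by blast
    then show "v \<in> \<theta> ` {1..m}"
    proof cases
      case 1
      then have "a = 1"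
        using apex_class pts by blast
      then show ?thesis
        using v 1 end_apex[of y b z c] idx pts dist by auto
    next
      case 2
      then have "b = 1"
        using apex_class pts by blast
      obtain i where i: "i \<in> {1..m}" "x = line_point (cot (\<theta> i))"
        using other[OF pts(1) idx(1)] idx \<open>b = 1\<close> by blast
      obtain j where j: "j \<in> {1..m}" "z = line_point (cot (\<theta> j))"
        using other[OF pts(3) idx(3)] idx \<open>b = 1\<close> by blast
      have "i \<noteq> j"
        using i j dist by auto
      then show ?thesis
        using v 2 i j \<theta>_diff \<theta>_bounds by (simp add: angle_at_apex)
    next
      case 3
      then have "c = 1"
        using apex_class pts by blast
      then show ?thesis
        using v 3 end_apex[of y b x a] idx pts dist angle_commute[of x] by auto
    next
      case 4
      \<comment> \<open>Three axis points give the angle 0 or \<open>pi\<close>, contradicting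
        \<open>v \<in> {0<..<pi}\<close>.\<close>
      then obtain s t u where "x = line_point s" "y = line_point u" "z = line_point t"
        using line[OF pts(1)] line[OF pts(2)] line[OF pts(3)] by blast
      then show ?thesis
        using angle_line_points[of s u t] v dist by auto
    qed
  qed
  then have "card (multipartite_angles k P) \<le> card {1..m}"
    by (meson surj_card_le finite_atLeastAtMost)
  with adm show ?thesis
    by auto
qed

theorem lemma5p8:
  fixes k n :: nat and r :: "nat \<Rightarrow> nat"
  assumes "k \<ge> 3"
    and "\<And>i j. 1 \<le> i \<Longrightarrow> i \<le> j \<Longrightarrow> j \<le> k \<Longrightarrow> r i \<ge> r j"
    and "r k \<ge> 1"
    and "n = (\<Sum>i=1..k. r i)"
  shows "int (A k r) \<le> 2 * (int n - int (r 1) - 1)"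
proof -
  define m where "m = (\<Sum>i=2..k. r i)"
  have r_pos: "r i \<ge> 1" if "i \<in> {1..k}" for i
    using assms(2)[of i k] assms(3) that by simp
  \<comment> \<open>There are \<open>k - 1 \<ge> 2\<close> classes besides the first, all
    nonempty.\<close>
  have "(\<Sum>i=2..k. 1) \<le> m"
    unfolding m_def using r_pos by (intro sum_mono) auto
  then have "m \<ge> 2"
    using assms(1) by simp
  moreover have "n = r 1 + m"
    using assms(1,4) by (simp add: m_def sum.atLeast_Suc_atMost numeral_2_eq_2)
  moreover obtain P where "admissible k r P" "card (multipartite_angles k P) \<le> m"
    using ex_admissible_few_angles[of k r] r_pos[of 1] assms(1) \<open>m \<ge> 2\<close> by (auto simp: m_def)
  \<comment> \<open>\<open>Inf\<close> of a set of naturals is below each member, so one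
    configuration suffices.\<close>
  then have "A k r \<le> m"
    unfolding A_def by (intro order_trans[OF cInf_lower]) auto
  \<comment> \<open>Since \<open>n - r 1 = m\<close>, what remains is
    \<open>m \<le> 2 * (m - 1)\<close>, which is \<open>m \<ge> 2\<close>.\<close>
  ultimately show ?thesis
    by simp
qed

end
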